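(* Let $\boldsymbol{\eta}\in\mathbb{R}^n$ and $\mathbf{f}_1,\dots,\mathbf{f}_M\in\mathbb{R}^n$ be deterministic, $\sigma>0$, and $\mathbf{Y}=\boldsymbol{\eta}+\boldsymbol{\xi}$ with $\boldsymbol{\xi}\sim N(0,\sigma^2\mathbf{I}_n)$. Let $\boldsymbol{\pi}\in\Lambda^M$, $\delta\in(0,1)$. Assume that $\nu\in(0,1)$ and $\omega^2\ge\frac{\sigma^2}{\min(\nu,1-\nu)}$. Then $$\|\boldsymbol{\psi}_X(\omega^2,\nu)-\boldsymbol{\eta}\|_2^2\le\min_{j\in\{1,\dots,M\}}\left\{\|\mathbf{f}_j-\boldsymbol{\eta}\|_2^2+2\omega^2\log\left(\frac{1}{\pi_j\delta}\right)\right\}$$ with probability at least $1-\delta$. Moreover, $$\mathbb{E}\|\boldsymbol{\psi}_X(\omega^2,\nu)-\boldsymbol{\eta}\|_2^2\le\min_{j\in\{1,\dots,M\}}\left\{\|\mathbf{f}_j-\boldsymbol{\eta}\|_2^2+2\omega^2\log\left(\frac{1}{\pi_j}\right)\right\}.$$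
   Context: $\Lambda^M=\{\boldsymbol{\lambda}\in\mathbb{R}^M:\lambda_j\ge 0,\ \sum_{j=1}^M\lambda_j=1\}$; $\log(1/0)=+\infty$. The BMAX estimator (a function of $\mathbf{Y}$) is $$\boldsymbol{\psi}_X(\omega^2,\nu)=\operatorname*{argmin}_{\boldsymbol{\psi}\in\mathbb{R}^n}J(\boldsymbol{\psi}),\qquad J(\boldsymbol{\psi})=\sum_{j=1}^M\pi_j\exp\left(-\frac{1}{2\omega^2}\|\mathbf{f}_j-\mathbf{Y}\|_2^2+\frac{1-\nu}{2\omega^2}\|\boldsymbol{\psi}-\mathbf{f}_j\|_2^2\right).$$ Probability and expectation are with respect to $\boldsymbol{\xi}$. *)

theory Defs
  imports "HOL-Probability.Probability"
begin

definition prob_simplex :: "(real ^ 'm) set" where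
  "prob_simplex = {l. (\<forall>j. 0 \<le> l $ j) \<and> (\<Sum>j\<in>UNIV. l $ j) = 1}"

(* p \<mapsto> log (1 / p) for p \<ge> 0, with the convention log (1 / 0) = \<infinity>;
   in type real, ln (1 / 0) would be 0. *)
definition log_inv :: "real \<Rightarrow> ereal" where
  "log_inv p = (if p = 0 then \<infinity> else ereal (ln (1 / p)))"

(* Lebesgue density of the normal distribution with mean 0 and covariance matrix \<sigma>\<^sup>2 I. *)
definition gaussian_density :: "real \<Rightarrow> real ^ 'n \<Rightarrow> real" where
  "gaussian_density \<sigma> x =
     1 / sqrt (2 * pi * \<sigma>\<^sup>2) ^ CARD('n) * exp (- (norm x)\<^sup>2 / (2 * \<sigma>\<^sup>2))"

lemma gaussian_density_eq_prod:
  "gaussian_density \<sigma> x = (\<Prod>i\<in>UNIV. normal_density 0 \<sigma> (x $ i))"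
proof -
  have "(norm x)\<^sup>2 = (\<Sum>i\<in>UNIV. (x $ i)\<^sup>2)"
    by (simp add: norm_vec_def L2_set_def sum_nonneg)
  then show ?thesis
    by (simp add: gaussian_density_def normal_density_def prod_dividef prod.distrib power_one_over
        sum_divide_distrib sum_negf flip: exp_sum)
qed

(* bmax is well-defined: for 0 < \<nu> < 1, w > 0 and p in the simplex the objective is continuous,
   strictly convex and coercive in \<psi>, hence it has exactly one minimiser.
   In the next two definitions the argument w stands for \<omega>\<^sup>2. *)
definition bmax_objective ::
  "(real ^ 'm) \<Rightarrow> ('m \<Rightarrow> real ^ 'n) \<Rightarrow> real \<Rightarrow> real \<Rightarrow> real ^ 'n \<Rightarrow> real ^ 'n \<Rightarrow> real" where
  "bmax_objective p f w \<nu> Y \<psi> =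
     (\<Sum>j\<in>UNIV. p $ j * exp (- 1 / (2 * w) * (norm (f j - Y))\<^sup>2
                           + (1 - \<nu>) / (2 * w) * (norm (\<psi> - f j))\<^sup>2))"

definition bmax ::
  "(real ^ 'm) \<Rightarrow> ('m \<Rightarrow> real ^ 'n) \<Rightarrow> real \<Rightarrow> real \<Rightarrow> real ^ 'n \<Rightarrow> real ^ 'n" where
  "bmax p f w \<nu> Y = arg_min (bmax_objective p f w \<nu> Y) (\<lambda>_. True)"

end

theory Submission
  imports Defs
begin

text \<open>
  At the minimiser \<open>\<psi>\<close> of \<open>J\<close> the weights \<open>q j = p j * exp (a j)\<close>, with \<open>a j\<close> the exponent in the
  \<open>j\<close>-th summand of \<open>J \<psi>\<close>, have \<open>\<psi>\<close> as their barycentre. Fix \<open>k\<close> and \<open>\<mu> = min \<nu> (1 - \<nu>)\<close>, and put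
  \<open>t j = (2 \<xi> \<bullet> (f j - f k) - \<mu> |f j - f k|\<^sup>2) / (2 \<omega>\<^sup>2)\<close>. Jensen's inequality for \<open>exp\<close> with weights
  \<open>q / J \<psi>\<close>, together with \<open>q k \<le> J \<psi>\<close>, gives the deterministic bound
  \<open>p k * exp ((|\<psi> - \<eta>|\<^sup>2 - |f k - \<eta>|\<^sup>2) / (2 \<omega>\<^sup>2)) \<le> S k\<close>, where \<open>S k = (\<Sum>j. p j * exp (t j))\<close>.
  The Gaussian moment generating function and \<open>\<sigma>\<^sup>2 \<le> \<mu> \<omega>\<^sup>2\<close> give \<open>E (S k) \<le> 1\<close>. Markov's inequality
  for \<open>S k\<close> yields the deviation bound, and \<open>ln (S k) \<le> S k - 1\<close> the bound in expectation. One
  \<open>k\<close> attaining the minimum suffices, since the right-hand sides are not random.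
\<close>

definition bmax_exponent ::
  "('m \<Rightarrow> real ^ 'n) \<Rightarrow> real \<Rightarrow> real \<Rightarrow> real ^ 'n \<Rightarrow> real ^ 'n \<Rightarrow> 'm \<Rightarrow> real" where
  "bmax_exponent f w \<nu> Y \<psi> j =
     - 1 / (2 * w) * (norm (f j - Y))\<^sup>2 + (1 - \<nu>) / (2 * w) * (norm (\<psi> - f j))\<^sup>2"

lemma bmax_objective_eq:
  "bmax_objective p f w \<nu> Y \<psi> = (\<Sum>j\<in>UNIV. p $ j * exp (bmax_exponent f w \<nu> Y \<psi> j))"
  by (simp add: bmax_objective_def bmax_exponent_def)

lemma prob_simplexD:
  assumes "p \<in> prob_simplex"
  shows "0 \<le> p $ j" and "(\<Sum>j\<in>UNIV. p $ j) = 1"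
  using assms by (auto simp: prob_simplex_def)

lemma prob_simplex_ex_pos:
  assumes "p \<in> prob_simplex"
  obtains k where "0 < p $ k"
proof -
  have "\<exists>k. p $ k \<noteq> 0"
    using prob_simplexD(2)[OF assms] by (metis sum.neutral zero_neq_one)
  then show ?thesis
    using that prob_simplexD(1)[OF assms] by (metis order_le_less)
qed

lemma bmax_objective_ge_term:
  assumes "p \<in> prob_simplex"
  shows "p $ k * exp (bmax_exponent f w \<nu> Y \<psi> k) \<le> bmax_objective p f w \<nu> Y \<psi>"
  unfolding bmax_objective_eq
  by (rule member_le_sum) (use prob_simplexD[OF assms] in auto)

lemma bmax_objective_pos:
  assumes "p \<in> prob_simplex"
  shows "0 < bmax_objective p f w \<nu> Y \<psi>"
proof -
  obtain k where "0 < p $ k"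
    using prob_simplex_ex_pos[OF assms] .
  then show ?thesis
    by (intro order_less_le_trans[OF _ bmax_objective_ge_term[OF assms, of k]] mult_pos_pos) auto
qed

lemma weighted_exp_jensen:
  fixes q h :: "'i \<Rightarrow> real"
  assumes "\<And>i. i \<in> A \<Longrightarrow> 0 \<le> q i" and "0 \<le> (\<Sum>i\<in>A. q i * (h i - m))"
  shows "(\<Sum>i\<in>A. q i) * exp m \<le> (\<Sum>i\<in>A. q i * exp (h i))"
proof -
  have "(\<Sum>i\<in>A. q i) * exp m \<le> exp m * ((\<Sum>i\<in>A. q i) + (\<Sum>i\<in>A. q i * (h i - m)))"
    using assms(2) by (simp add: algebra_simps)
  also have "\<dots> = (\<Sum>i\<in>A. q i * (exp m * (1 + (h i - m))))"
    by (simp add: sum_distrib_left sum.distrib[symmetric] algebra_simps)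
  also have "\<dots> \<le> (\<Sum>i\<in>A. q i * exp (h i))"
  proof (rule sum_mono)
    fix i assume "i \<in> A"
    have "exp m * (1 + (h i - m)) \<le> exp m * exp (h i - m)"
      by (intro mult_left_mono exp_ge_add_one_self) auto
    also have "\<dots> = exp (h i)"
      by (simp flip: exp_add)
    finally show "q i * (exp m * (1 + (h i - m))) \<le> q i * exp (h i)"
      using assms(1)[OF \<open>i \<in> A\<close>] by (rule mult_left_mono)
  qed
  finally show ?thesis .
qed

lemma bmax_objective_has_derivative:
  "(bmax_objective p f w \<nu> Y has_derivative
     (\<lambda>h. (\<Sum>j\<in>UNIV. p $ j * (exp (bmax_exponent f w \<nu> Y \<psi> j) * ((1 - \<nu>) / w * ((\<psi> - f j) \<bullet> h)))))) (at \<psi>)"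
proof -
  have "((\<lambda>\<psi>. bmax_exponent f w \<nu> Y \<psi> j) has_derivative (\<lambda>h. (1 - \<nu>) / w * ((\<psi> - f j) \<bullet> h))) (at \<psi>)" for j
    unfolding bmax_exponent_def power2_norm_eq_inner
    by (rule derivative_eq_intros refl)+ (simp add: inner_commute)
  then show ?thesis
    unfolding bmax_objective_eq[abs_def]
    by (intro has_derivative_sum has_derivative_mult_right) (auto intro!: derivative_eq_intros)
qed

lemma bmax_objective_ex_min:
  assumes p: "p \<in> prob_simplex" and w: "0 < w" and \<nu>: "\<nu> < 1"
  shows "\<exists>\<psi>. \<forall>\<phi>. bmax_objective p f w \<nu> Y \<psi> \<le> bmax_objective p f w \<nu> Y \<phi>"
proof -
  let ?J = "bmax_objective p f w \<nu> Y"
  obtain k where k: "0 < p $ k"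
    using prob_simplex_ex_pos[OF p] .
  define c where "c = (1 - \<nu>) / (2 * w)"
  define B where "B = p $ k * exp (- 1 / (2 * w) * (norm (f k - Y))\<^sup>2)"
  have c: "0 < c" and B: "0 < B"
    using w \<nu> k by (auto simp: c_def B_def)
  have lower: "B * (c * (norm (\<phi> - f k))\<^sup>2) \<le> ?J \<phi>" for \<phi>
  proof -
    have "B * (c * (norm (\<phi> - f k))\<^sup>2) \<le> B * exp (c * (norm (\<phi> - f k))\<^sup>2)"
      using B exp_ge_add_one_self[of "c * (norm (\<phi> - f k))\<^sup>2"]
      by (intro mult_left_mono) linarith+
    also have "\<dots> = p $ k * exp (bmax_exponent f w \<nu> Y \<phi> k)"
      by (simp add: B_def c_def bmax_exponent_def mult.assoc flip: exp_add)
    also have "\<dots> \<le> ?J \<phi>"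
      by (rule bmax_objective_ge_term[OF p])
    finally show ?thesis .
  qed
  define R where "R = sqrt (?J (f k) / (B * c))"
  have "continuous_on (cball (f k) R) ?J"
    by (meson bmax_objective_has_derivative continuous_at_imp_continuous_on has_derivative_continuous)
  moreover have R0: "0 \<le> R"
    using bmax_objective_pos[OF p, of f w \<nu> Y "f k"] B c by (simp add: R_def)
  ultimately obtain \<psi> where \<psi>: "\<And>\<phi>. \<phi> \<in> cball (f k) R \<Longrightarrow> ?J \<psi> \<le> ?J \<phi>"
    using continuous_attains_inf[of "cball (f k) R" ?J] by (metis cball_eq_empty compact_cball not_le)
  have "?J \<psi> \<le> ?J \<phi>" for \<phi>
  proof (cases "\<phi> \<in> cball (f k) R")
    case False
    then have "R < norm (\<phi> - f k)"
      by (simp add: dist_norm norm_minus_commute)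
    then have "R\<^sup>2 < (norm (\<phi> - f k))\<^sup>2"
      using R0 by (intro power_strict_mono) auto
    moreover have "R\<^sup>2 = ?J (f k) / (B * c)"
      using bmax_objective_pos[OF p, of f w \<nu> Y "f k"] B c by (simp add: R_def)
    ultimately have "?J (f k) < B * (c * (norm (\<phi> - f k))\<^sup>2)"
      using B c by (simp add: pos_divide_less_eq mult.commute mult.left_commute)
    then show ?thesis
      using \<psi>[of "f k"] R0 lower[of \<phi>] by auto
  qed (rule \<psi>)
  then show ?thesis by blast
qed

lemma bmax_minimal:
  assumes "p \<in> prob_simplex" and "0 < w" and "\<nu> < 1"
  shows "bmax_objective p f w \<nu> Y (bmax p f w \<nu> Y) \<le> bmax_objective p f w \<nu> Y \<phi>"
proof -
  obtain \<psi> where \<psi>: "\<forall>\<phi>. bmax_objective p f w \<nu> Y \<psi> \<le> bmax_objective p f w \<nu> Y \<phi>"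
    using bmax_objective_ex_min[OF assms] by blast
  show ?thesis
    unfolding bmax_def by (rule arg_minI[of _ \<psi>]) (use \<psi> in \<open>auto simp: not_less\<close>)
qed

lemma bmax_first_order:
  fixes f :: "'m::finite \<Rightarrow> real ^ 'n"
  assumes "p \<in> prob_simplex" and w: "0 < w" and \<nu>: "\<nu> < 1"
  defines "\<psi> \<equiv> bmax p f w \<nu>"
  shows "(\<Sum>j\<in>UNIV. p $ j * exp (bmax_exponent f w \<nu> Y (\<psi> Y) j) * ((f j - \<psi> Y) \<bullet> u)) = 0"
proof -
  let ?D = "\<lambda>h. (\<Sum>j\<in>UNIV. p $ j * (exp (bmax_exponent f w \<nu> Y (\<psi> Y) j)
              * ((1 - \<nu>) / w * ((\<psi> Y - f j) \<bullet> h))))"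
  have "?D = (\<lambda>h. 0)"
    by (rule has_derivative_local_min[OF bmax_objective_has_derivative])
       (auto simp: \<psi>_def intro!: always_eventually bmax_minimal[OF assms(1-3)])
  then have "?D u = 0"
    by (rule fun_cong)
  moreover have "?D u = - ((1 - \<nu>) / w) *
      (\<Sum>j\<in>UNIV. p $ j * exp (bmax_exponent f w \<nu> Y (\<psi> Y) j) * ((f j - \<psi> Y) \<bullet> u))"
    unfolding sum_distrib_left by (intro sum.cong) (simp_all add: inner_diff_left algebra_simps diff_divide_distrib)
  ultimately show ?thesis
    using w \<nu> by simp
qed

lemma bmax_objective_growth:
  assumes p: "p \<in> prob_simplex" and w: "0 < w" and \<nu>: "\<nu> < 1"
  shows "bmax_objective p f w \<nu> Y (bmax p f w \<nu> Y)
           * exp ((1 - \<nu>) / (2 * w) * (norm (\<phi> - bmax p f w \<nu> Y))\<^sup>2)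
         \<le> bmax_objective p f w \<nu> Y \<phi>"
proof -
  define \<psi> where "\<psi> = bmax p f w \<nu> Y"
  define q where "q j = p $ j * exp (bmax_exponent f w \<nu> Y \<psi> j)" for j
  define h where "h j = bmax_exponent f w \<nu> Y \<phi> j - bmax_exponent f w \<nu> Y \<psi> j" for j
  let ?m = "(1 - \<nu>) / (2 * w) * (norm (\<phi> - \<psi>))\<^sup>2"
  have h: "h j - ?m = (f j - \<psi>) \<bullet> (- ((1 - \<nu>) / w) *\<^sub>R (\<phi> - \<psi>))" for j
    using w unfolding h_def bmax_exponent_def power2_norm_eq_inner
    by (simp add: field_simps inner_diff_left inner_diff_right inner_commute)
  have "(\<Sum>j\<in>UNIV. q j * ((f j - \<psi>) \<bullet> (- ((1 - \<nu>) / w) *\<^sub>R (\<phi> - \<psi>)))) = 0"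
    unfolding q_def \<psi>_def by (rule bmax_first_order[OF assms])
  then have "(\<Sum>j\<in>UNIV. q j * (h j - ?m)) = 0"
    by (simp only: h)
  then have "(\<Sum>j\<in>UNIV. q j) * exp ?m \<le> (\<Sum>j\<in>UNIV. q j * exp (h j))"
    by (intro weighted_exp_jensen) (auto simp: q_def prob_simplexD[OF p])
  then show ?thesis
    by (simp add: bmax_objective_eq q_def h_def \<psi>_def mult.assoc flip: exp_add)
qed

lemma isCont_bmax:
  assumes p: "p \<in> prob_simplex" and w: "0 < w" and \<nu>: "\<nu> < 1"
  shows "isCont (bmax p f w \<nu>) Y"
proof -
  let ?J = "bmax_objective p f w \<nu>" and ?\<psi> = "bmax p f w \<nu>"
  \<comment> \<open>Moving \<open>Y\<close> to \<open>Z\<close> changes every summand, hence the objective, by a factor at most \<open>exp (e Z)\<close>,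
    uniformly in \<open>\<phi>\<close>; quadratic growth then keeps the two minimisers close.\<close>
  define e where "e Z = (\<Sum>j\<in>UNIV. \<bar>(norm (f j - Y))\<^sup>2 - (norm (f j - Z))\<^sup>2\<bar> / (2 * w))" for Z
  define c where "c = (1 - \<nu>) / (2 * w)"
  have c: "0 < c"
    using w \<nu> by (simp add: c_def)
  have e: "\<bar>bmax_exponent f w \<nu> Y \<phi> j - bmax_exponent f w \<nu> Z \<phi> j\<bar> \<le> e Z" for \<phi> Z j
  proof -
    have "\<bar>bmax_exponent f w \<nu> Y \<phi> j - bmax_exponent f w \<nu> Z \<phi> j\<bar>
        = \<bar>((norm (f j - Y))\<^sup>2 - (norm (f j - Z))\<^sup>2) / (2 * w)\<bar>"
      using w by (simp add: bmax_exponent_def abs_divide diff_divide_distrib abs_minus_commute)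
    also have "\<dots> = \<bar>(norm (f j - Y))\<^sup>2 - (norm (f j - Z))\<^sup>2\<bar> / (2 * w)"
      using w by (simp add: abs_divide)
    also have "\<dots> \<le> e Z"
      unfolding e_def by (rule member_le_sum) (use w in auto)
    finally show ?thesis .
  qed
  have cmp1: "?J Y \<phi> \<le> ?J Z \<phi> * exp (e Z)" and cmp2: "?J Z \<phi> \<le> ?J Y \<phi> * exp (e Z)" for \<phi> Z
    using e[of \<phi> _ Z] unfolding bmax_objective_eq sum_distrib_right mult.assoc exp_add[symmetric]
    by (auto intro!: sum_mono mult_left_mono prob_simplexD[OF p] simp: abs_le_iff algebra_simps)
  have bound: "c * (norm (?\<psi> Z - ?\<psi> Y))\<^sup>2 \<le> 2 * e Z" for Z
  proof -
    have "?J Y (?\<psi> Y) * exp (c * (norm (?\<psi> Z - ?\<psi> Y))\<^sup>2) \<le> ?J Y (?\<psi> Z)"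
      unfolding c_def by (rule bmax_objective_growth[OF assms])
    also have "\<dots> \<le> ?J Z (?\<psi> Z) * exp (e Z)"
      by (rule cmp1)
    also have "\<dots> \<le> ?J Z (?\<psi> Y) * exp (e Z)"
      by (intro mult_right_mono bmax_minimal[OF assms]) auto
    also have "\<dots> \<le> ?J Y (?\<psi> Y) * exp (e Z) * exp (e Z)"
      by (intro mult_right_mono cmp2) auto
    also have "\<dots> = ?J Y (?\<psi> Y) * exp (2 * e Z)"
      by (simp flip: exp_add)
    finally show ?thesis
      using bmax_objective_pos[OF p, of f w \<nu> Y "?\<psi> Y"] by simp
  qed
  have "isCont e Y"
    unfolding e_def using w by (intro continuous_intros) auto
  then have "isCont (\<lambda>Z. sqrt (2 * e Z / c)) Y"
    using c by (intro continuous_intros) auto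
  then have "(\<lambda>Z. sqrt (2 * e Z / c)) \<midarrow>Y\<rightarrow> sqrt (2 * e Y / c)"
    by (simp add: isCont_def)
  moreover have "e Y = 0"
    by (simp add: e_def)
  ultimately have lim: "(\<lambda>Z. sqrt (2 * e Z / c)) \<midarrow>Y\<rightarrow> 0"
    by simp
  have "norm (?\<psi> Z - ?\<psi> Y) \<le> sqrt (2 * e Z / c)" for Z
    using bound[of Z] c by (intro real_le_rsqrt) (simp add: pos_le_divide_eq mult.commute)
  then have "(\<lambda>Z. ?\<psi> Z - ?\<psi> Y) \<midarrow>Y\<rightarrow> 0"
    by (intro Lim_null_comparison[OF _ lim] always_eventually allI)
  then show ?thesis
    by (simp add: isCont_def LIM_zero_iff)
qed

lemma borel_measurable_bmax:
  assumes "p \<in> prob_simplex" and "0 < w" and "\<nu> < 1"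
  shows "bmax p f w \<nu> \<in> borel_measurable borel"
  by (intro borel_measurable_continuous_onI continuous_at_imp_continuous_on ballI
      isCont_bmax[OF assms])

lemma bmax_oracle_inequality:
  assumes p: "p \<in> prob_simplex" and w: "0 < w" and \<nu>: "\<nu> < 1" and \<mu>: "\<mu> \<le> \<nu>" "\<mu> \<le> 1 - \<nu>"
  shows "p $ k * exp (((norm (bmax p f w \<nu> (\<eta> + z) - \<eta>))\<^sup>2 - (norm (f k - \<eta>))\<^sup>2) / (2 * w))
    \<le> (\<Sum>j\<in>UNIV. p $ j * exp ((2 * (z \<bullet> (f j - f k)) - \<mu> * (norm (f j - f k))\<^sup>2) / (2 * w)))"
proof -
  define Y where "Y = \<eta> + z"
  define \<psi> where "\<psi> = bmax p f w \<nu> Y"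
  define a where "a j = bmax_exponent f w \<nu> Y \<psi> j" for j
  define q where "q j = p $ j * exp (a j)" for j
  define t where "t j = (2 * (z \<bullet> (f j - f k)) - \<mu> * (norm (f j - f k))\<^sup>2) / (2 * w)" for j
  define g where "g = ((norm (\<psi> - \<eta>))\<^sup>2 - (norm (f k - \<eta>))\<^sup>2) / (2 * w)"
  define u where "u = (1 / w) *\<^sub>R ((\<psi> - \<eta>) - \<mu> *\<^sub>R (\<psi> - f k))"
  have q: "0 \<le> q j" for j
    by (simp add: q_def prob_simplexD[OF p])
  have "(f j - \<psi>) \<bullet> u \<le> t j - a j - (g - a k)" for j
  proof -
    have "2 * w * (t j - a j - (g - a k) - (f j - \<psi>) \<bullet> u)
        = (\<nu> - \<mu>) * (norm (f j - \<psi>))\<^sup>2 + (1 - \<nu> - \<mu>) * (norm (\<psi> - f k))\<^sup>2"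
      using w unfolding t_def a_def bmax_exponent_def g_def u_def Y_def power2_norm_eq_inner
      by (simp add: field_simps inner_diff_left inner_diff_right inner_add_left inner_add_right inner_commute)
    also have "\<dots> \<ge> 0"
      using \<mu> by simp
    finally show ?thesis
      using w by (simp add: zero_le_mult_iff)
  qed
  then have "(\<Sum>j\<in>UNIV. q j * ((f j - \<psi>) \<bullet> u)) \<le> (\<Sum>j\<in>UNIV. q j * (t j - a j - (g - a k)))"
    by (intro sum_mono mult_left_mono q)
  moreover have "(\<Sum>j\<in>UNIV. q j * ((f j - \<psi>) \<bullet> u)) = 0"
    unfolding q_def a_def \<psi>_def by (rule bmax_first_order[OF p w \<nu>])
  ultimately have "(\<Sum>j\<in>UNIV. q j) * exp (g - a k) \<le> (\<Sum>j\<in>UNIV. q j * exp (t j - a j))"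
    by (intro weighted_exp_jensen q) simp
  also have "\<dots> = (\<Sum>j\<in>UNIV. p $ j * exp (t j))"
    by (simp add: q_def mult.assoc flip: exp_add)
  finally have "(\<Sum>j\<in>UNIV. q j) * exp (g - a k) \<le> (\<Sum>j\<in>UNIV. p $ j * exp (t j))" .
  moreover have "p $ k * exp g \<le> (\<Sum>j\<in>UNIV. q j) * exp (g - a k)"
  proof -
    have "q k * exp (g - a k) \<le> (\<Sum>j\<in>UNIV. q j) * exp (g - a k)"
      by (intro mult_right_mono member_le_sum) (auto simp: q)
    then show ?thesis
      by (simp add: q_def mult.assoc flip: exp_add)
  qed
  ultimately show ?thesis
    by (simp add: g_def t_def \<psi>_def Y_def)
qed

lemma gaussian_density_tilt:
  assumes "\<sigma> > 0"
  shows "gaussian_density \<sigma> x * exp (x \<bullet> u)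
           = exp (\<sigma>\<^sup>2 * (norm u)\<^sup>2 / 2) * gaussian_density \<sigma> (x - \<sigma>\<^sup>2 *\<^sub>R u)"
proof -
  have "- (norm x)\<^sup>2 / (2 * \<sigma>\<^sup>2) + x \<bullet> u
      = \<sigma>\<^sup>2 * (norm u)\<^sup>2 / 2 + - (norm (x - \<sigma>\<^sup>2 *\<^sub>R u))\<^sup>2 / (2 * \<sigma>\<^sup>2)"
    using assms unfolding power2_norm_eq_inner
    by (simp add: field_simps inner_diff_left inner_diff_right inner_commute)
  then show ?thesis
    by (simp add: gaussian_density_def mult.left_commute flip: exp_add)
qed

lemma gaussian_density_nonneg: "0 \<le> gaussian_density \<sigma> x"
  by (simp add: gaussian_density_def)

lemma borel_measurable_gaussian_density [measurable]:
  "gaussian_density \<sigma> \<in> borel_measurable borel"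
  unfolding gaussian_density_def by measurable

lemma nn_integral_exp_inner_gaussian:
  fixes \<xi> :: "'a \<Rightarrow> real ^ 'n"
  assumes "prob_space P" and \<sigma>: "\<sigma> > 0"
    and d: "distributed P lborel \<xi> (\<lambda>x. ennreal (gaussian_density \<sigma> x))"
  shows "(\<integral>\<^sup>+x. ennreal (exp (\<xi> x \<bullet> u)) \<partial>P) = ennreal (exp (\<sigma>\<^sup>2 * (norm u)\<^sup>2 / 2))"
proof -
  interpret prob_space P by fact
  let ?G = "\<lambda>x :: real ^ 'n. ennreal (gaussian_density \<sigma> x)"
  let ?K = "ennreal (exp (\<sigma>\<^sup>2 * (norm u)\<^sup>2 / 2))"
  have total: "(\<integral>\<^sup>+x. ?G x \<partial>lborel) = 1"
    using distributed_nn_integral[OF d, of "\<lambda>_. 1"] by (simp add: emeasure_space_1)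
  have "(\<integral>\<^sup>+x. ennreal (exp (\<xi> x \<bullet> u)) \<partial>P) = (\<integral>\<^sup>+x. ?G x * ennreal (exp (x \<bullet> u)) \<partial>lborel)"
    by (rule distributed_nn_integral[OF d, symmetric]) measurable
  also have "\<dots> = (\<integral>\<^sup>+x. ?K * ?G (x - \<sigma>\<^sup>2 *\<^sub>R u) \<partial>lborel)"
    by (intro nn_integral_cong)
       (simp add: gaussian_density_tilt[OF \<sigma>] gaussian_density_nonneg flip: ennreal_mult)
  also have "\<dots> = ?K * (\<integral>\<^sup>+x. ?G (x - \<sigma>\<^sup>2 *\<^sub>R u) \<partial>lborel)"
    by (intro nn_integral_cmult) measurable
  also have "(\<integral>\<^sup>+x. ?G (x - \<sigma>\<^sup>2 *\<^sub>R u) \<partial>lborel)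
      = (\<integral>\<^sup>+x. ?G x \<partial>distr lborel borel ((+) (- (\<sigma>\<^sup>2 *\<^sub>R u))))"
    by (subst nn_integral_distr) auto
  also have "\<dots> = 1"
    by (simp add: lborel_distr_plus total)
  finally show ?thesis by simp
qed

lemma gaussian_aggregate_moment:
  fixes \<xi> :: "'a \<Rightarrow> real ^ 'n" and v :: "'m::finite \<Rightarrow> real ^ 'n"
  assumes P: "prob_space P" and \<sigma>: "\<sigma> > 0"
    and d: "distributed P lborel \<xi> (\<lambda>x. ennreal (gaussian_density \<sigma> x))"
    and p: "p \<in> prob_simplex" and w: "0 < w" and \<mu>: "\<sigma>\<^sup>2 \<le> \<mu> * w"
  defines "S \<equiv> \<lambda>x. \<Sum>j\<in>UNIV. p $ j * exp ((2 * (\<xi> x \<bullet> v j) - \<mu> * (norm (v j))\<^sup>2) / (2 * w))"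
  shows "integrable P S" and "integral\<^sup>L P S \<le> 1"
proof -
  have [measurable]: "\<xi> \<in> borel_measurable P"
    using distributed_measurable[OF d] by simp
  define E where "E j x = exp ((2 * (\<xi> x \<bullet> v j) - \<mu> * (norm (v j))\<^sup>2) / (2 * w))" for j x
  have [measurable]: "E j \<in> borel_measurable P" for j
    unfolding E_def by measurable
  have "(\<integral>\<^sup>+x. ennreal (E j x) \<partial>P) \<le> 1" for j
  proof -
    let ?u = "(1 / w) *\<^sub>R v j" and ?C = "exp (- (\<mu> * (norm (v j))\<^sup>2) / (2 * w))"
    have "E j x = ?C * exp (\<xi> x \<bullet> ?u)" for x
      using w by (simp add: E_def diff_divide_distrib flip: exp_add)
    then have "(\<integral>\<^sup>+x. ennreal (E j x) \<partial>P) = (\<integral>\<^sup>+x. ennreal ?C * ennreal (exp (\<xi> x \<bullet> ?u)) \<partial>P)"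
      by (simp add: ennreal_mult)
    also have "\<dots> = ennreal ?C * (\<integral>\<^sup>+x. ennreal (exp (\<xi> x \<bullet> ?u)) \<partial>P)"
      by (intro nn_integral_cmult) measurable
    also have "\<dots> = ennreal (exp (- (\<mu> * (norm (v j))\<^sup>2) / (2 * w) + \<sigma>\<^sup>2 * (norm ?u)\<^sup>2 / 2))"
      by (simp only: nn_integral_exp_inner_gaussian[OF P \<sigma> d] exp_add ennreal_mult exp_ge_zero)
    also have "- (\<mu> * (norm (v j))\<^sup>2) / (2 * w) + \<sigma>\<^sup>2 * (norm ?u)\<^sup>2 / 2
        = (\<sigma>\<^sup>2 - \<mu> * w) * ((norm (v j))\<^sup>2 / (2 * w\<^sup>2))"
      using w by (simp add: power_mult_distrib power_divide field_simps power2_eq_square)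
    also have "ennreal (exp \<dots>) \<le> 1"
      using mult_nonpos_nonneg[of "\<sigma>\<^sup>2 - \<mu> * w" "(norm (v j))\<^sup>2 / (2 * w\<^sup>2)"] \<mu> by simp
    finally show ?thesis .
  qed
  note E1 = this
  have int: "integrable P (E j)" for j
    using E1[of j] by (intro integrableI_nonneg) (auto simp: E_def intro: le_less_trans)
  have "integral\<^sup>L P (E j) \<le> 1" for j
  proof -
    have "ennreal (integral\<^sup>L P (E j)) \<le> 1"
      using E1[of j] nn_integral_eq_integral[OF int[of j]] by (simp add: E_def)
    then show ?thesis by simp
  qed
  then have "(\<Sum>j\<in>UNIV. p $ j * integral\<^sup>L P (E j)) \<le> (\<Sum>j\<in>UNIV. p $ j * 1)"
    by (intro sum_mono mult_left_mono prob_simplexD[OF p])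
  moreover have S: "S = (\<lambda>x. \<Sum>j\<in>UNIV. p $ j * E j x)"
    by (simp add: S_def E_def)
  ultimately show "integrable P S" "integral\<^sup>L P S \<le> 1"
    using int by (simp_all add: prob_simplexD[OF p])
qed

theorem corollary2:
  fixes P :: "'a measure"
    and \<xi> :: "'a \<Rightarrow> real ^ 'n"
    and \<eta> :: "real ^ 'n"
    and f :: "'m::finite \<Rightarrow> real ^ 'n"
    and p :: "real ^ 'm"
    and \<sigma> \<delta> \<nu> \<omega> :: real
  assumes "prob_space P"
    and "\<sigma> > 0"
    and "distributed P lborel \<xi> (\<lambda>x. ennreal (gaussian_density \<sigma> x))"
    and "p \<in> prob_simplex"
    and "0 < \<delta>" and "\<delta> < 1"
    and "0 < \<nu>" and "\<nu> < 1"
    and "\<omega>\<^sup>2 \<ge> \<sigma>\<^sup>2 / min \<nu> (1 - \<nu>)"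
  shows "measure P {x \<in> space P.
             ereal ((norm (bmax p f (\<omega>\<^sup>2) \<nu> (\<eta> + \<xi> x) - \<eta>))\<^sup>2)
               \<le> (MIN j. ereal ((norm (f j - \<eta>))\<^sup>2) + ereal (2 * \<omega>\<^sup>2) * log_inv (p $ j * \<delta>))}
           \<ge> 1 - \<delta>
       \<and> integrable P (\<lambda>x. (norm (bmax p f (\<omega>\<^sup>2) \<nu> (\<eta> + \<xi> x) - \<eta>))\<^sup>2)
       \<and> ereal (integral\<^sup>L P (\<lambda>x. (norm (bmax p f (\<omega>\<^sup>2) \<nu> (\<eta> + \<xi> x) - \<eta>))\<^sup>2))
           \<le> (MIN j. ereal ((norm (f j - \<eta>))\<^sup>2) + ereal (2 * \<omega>\<^sup>2) * log_inv (p $ j))"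
proof -
  interpret prob_space P by fact
  note p = assms(4)
  define w where "w = \<omega>\<^sup>2"
  define \<mu> where "\<mu> = min \<nu> (1 - \<nu>)"
  have \<mu>: "0 < \<mu>" "\<mu> \<le> \<nu>" "\<mu> \<le> 1 - \<nu>"
    using assms by (auto simp: \<mu>_def)
  have "0 < \<sigma>\<^sup>2 / \<mu>"
    using assms \<mu> by simp
  then have w: "0 < w" and \<sigma>w: "\<sigma>\<^sup>2 \<le> \<mu> * w"
    using assms(9) \<mu> unfolding w_def \<mu>_def[symmetric]
    by (linarith, simp add: pos_divide_le_eq mult.commute)
  have [measurable]: "\<xi> \<in> borel_measurable P"
    using distributed_measurable[OF assms(3)] by simp
  note [measurable] = borel_measurable_bmax[OF p w \<open>\<nu> < 1\<close>]
  define L where "L x = (norm (bmax p f w \<nu> (\<eta> + \<xi> x) - \<eta>))\<^sup>2" for x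
  have [measurable]: "L \<in> borel_measurable P"
    unfolding L_def by measurable
  define S where "S k x =
    (\<Sum>j\<in>UNIV. p $ j * exp ((2 * (\<xi> x \<bullet> (f j - f k)) - \<mu> * (norm (f j - f k))\<^sup>2) / (2 * w)))" for k x
  have S_int: "integrable P (S k)" and S_le: "expectation (S k) \<le> 1" for k
    unfolding S_def
    using gaussian_aggregate_moment[OF assms(1-3) p w \<sigma>w, of "\<lambda>j. f j - f k"] by auto
  have S_nonneg: "0 \<le> S k x" for k x
    by (auto simp: S_def intro!: sum_nonneg mult_nonneg_nonneg prob_simplexD[OF p])
  have S_ge: "p $ k * exp ((L x - (norm (f k - \<eta>))\<^sup>2) / (2 * w)) \<le> S k x" for k x
    unfolding L_def S_def by (rule bmax_oracle_inequality[OF p w \<open>\<nu> < 1\<close> \<mu>(2,3)])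
  have L_le: "L x \<le> (norm (f k - \<eta>))\<^sup>2 + 2 * w * (ln c + ln (1 / p $ k))"
    if "0 < p $ k" and "S k x \<le> c" for k x c
  proof -
    have "0 < p $ k * exp ((L x - (norm (f k - \<eta>))\<^sup>2) / (2 * w))"
      using that by simp
    also have le: "\<dots> \<le> c"
      using S_ge[of k x] that by simp
    finally have "0 < c" .
    have "exp ((L x - (norm (f k - \<eta>))\<^sup>2) / (2 * w)) \<le> c / p $ k"
      using le that by (simp add: pos_le_divide_eq mult.commute)
    then have "(L x - (norm (f k - \<eta>))\<^sup>2) / (2 * w) \<le> ln (c / p $ k)"
      using \<open>0 < c\<close> that by (subst ln_ge_iff) auto
    also have "\<dots> = ln c + ln (1 / p $ k)"
      using \<open>0 < c\<close> that by (simp add: ln_div)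
    finally show ?thesis
      using w by (simp add: pos_divide_le_eq algebra_simps)
  qed
  have L_le_lin: "L x \<le> (norm (f k - \<eta>))\<^sup>2 + 2 * w * (S k x - 1 + ln (1 / p $ k))"
    if "0 < p $ k" for k x
  proof -
    have "0 < p $ k * exp ((L x - (norm (f k - \<eta>))\<^sup>2) / (2 * w))"
      using that by simp
    then have "ln (S k x) \<le> S k x - 1"
      using S_ge[of k x] by (intro ln_le_minus_one) linarith
    then have "2 * w * (ln (S k x) + ln (1 / p $ k)) \<le> 2 * w * (S k x - 1 + ln (1 / p $ k))"
      using w by (intro mult_left_mono) auto
    then show ?thesis
      using L_le[OF that order_refl, of x] by linarith
  qed
  obtain k0 where k0: "0 < p $ k0"
    using prob_simplex_ex_pos[OF p] .
  have L_int: "integrable P L"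
  proof (rule Bochner_Integration.integrable_bound)
    show "integrable P (\<lambda>x. (norm (f k0 - \<eta>))\<^sup>2 + 2 * w * (S k0 x - 1 + ln (1 / p $ k0)))"
      using S_int by auto
    show "AE x in P. norm (L x) \<le> norm ((norm (f k0 - \<eta>))\<^sup>2 + 2 * w * (S k0 x - 1 + ln (1 / p $ k0)))"
      using L_le_lin[OF k0] by (intro always_eventually allI) (simp add: L_def order_trans[OF _ abs_ge_self])
  qed measurable
  have L_exp: "expectation L \<le> (norm (f k - \<eta>))\<^sup>2 + 2 * w * ln (1 / p $ k)" if k: "0 < p $ k" for k
  proof -
    have "expectation L \<le> expectation (\<lambda>x. (norm (f k - \<eta>))\<^sup>2 + 2 * w * (S k x - 1 + ln (1 / p $ k)))"
      using S_int L_le_lin[OF k] L_int by (intro integral_mono) auto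
    also have "\<dots> = (norm (f k - \<eta>))\<^sup>2 + 2 * w * (expectation (S k) - 1 + ln (1 / p $ k))"
      using S_int by (simp add: prob_space)
    also have "\<dots> \<le> (norm (f k - \<eta>))\<^sup>2 + 2 * w * ln (1 / p $ k)"
      using S_le[of k] w by simp
    finally show ?thesis .
  qed
  have tail: "1 - \<delta> \<le> prob {x \<in> space P. L x \<le> (norm (f k - \<eta>))\<^sup>2 + 2 * w * ln (1 / (p $ k * \<delta>))}"
    if k: "0 < p $ k" for k
  proof -
    have [measurable]: "S k \<in> borel_measurable P"
      using S_int by auto
    have "prob {x \<in> space P. 1 / \<delta> \<le> S k x} \<le> expectation (S k) / (1 / \<delta>)"
      using S_nonneg \<open>0 < \<delta>\<close> S_int by (intro integral_Markov_inequality_measure[where A = "space P"]) auto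
    also have "\<dots> \<le> \<delta>"
      using S_le[of k] \<open>0 < \<delta>\<close> by simp
    finally have "1 - \<delta> \<le> 1 - prob {x \<in> space P. 1 / \<delta> \<le> S k x}"
      by simp
    also have "\<dots> = prob {x \<in> space P. \<not> 1 / \<delta> \<le> S k x}"
      by (intro prob_neg[symmetric]) measurable
    also have "\<dots> \<le> prob {x \<in> space P. L x \<le> (norm (f k - \<eta>))\<^sup>2 + 2 * w * ln (1 / (p $ k * \<delta>))}"
    proof (rule finite_measure_mono)
      have "ln (1 / \<delta>) + ln (1 / p $ k) = ln (1 / (p $ k * \<delta>))"
        using k \<open>0 < \<delta>\<close> by (simp add: ln_div ln_mult)
      then show "{x \<in> space P. \<not> 1 / \<delta> \<le> S k x}
          \<subseteq> {x \<in> space P. L x \<le> (norm (f k - \<eta>))\<^sup>2 + 2 * w * ln (1 / (p $ k * \<delta>))}"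
        using L_le[OF k, of _ "1 / \<delta>"] by auto
    qed measurable
    finally show ?thesis .
  qed
  have bound_eq: "ereal ((norm (f k - \<eta>))\<^sup>2) + ereal (2 * w) * log_inv (p $ k * c)
      = (if p $ k = 0 then \<infinity> else ereal ((norm (f k - \<eta>))\<^sup>2 + 2 * w * ln (1 / (p $ k * c))))"
    if "0 < c" for k c
    using that w by (simp add: log_inv_def)
  have ex_min: "\<exists>k. (MIN j. ereal ((norm (f j - \<eta>))\<^sup>2) + ereal (2 * w) * log_inv (p $ j * c))
      = ereal ((norm (f k - \<eta>))\<^sup>2) + ereal (2 * w) * log_inv (p $ k * c)" for c
    using Min_in[of "range (\<lambda>j. ereal ((norm (f j - \<eta>))\<^sup>2) + ereal (2 * w) * log_inv (p $ j * c))"]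
    unfolding image_iff by simp
  have pos: "0 < p $ k" if "p $ k \<noteq> 0" for k
    using that prob_simplexD(1)[OF p, of k] by simp
  have "1 - \<delta> \<le> prob {x \<in> space P. ereal (L x)
      \<le> (MIN j. ereal ((norm (f j - \<eta>))\<^sup>2) + ereal (2 * w) * log_inv (p $ j * \<delta>))}"
  proof -
    obtain k where k: "(MIN j. ereal ((norm (f j - \<eta>))\<^sup>2) + ereal (2 * w) * log_inv (p $ j * \<delta>))
        = ereal ((norm (f k - \<eta>))\<^sup>2) + ereal (2 * w) * log_inv (p $ k * \<delta>)"
      using ex_min by blast
    show ?thesis
      unfolding k unfolding bound_eq[OF \<open>0 < \<delta>\<close>]
      using tail[OF pos] \<open>0 < \<delta>\<close> by (cases "p $ k = 0") (auto simp: prob_space)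
  qed
  moreover have "ereal (expectation L)
      \<le> (MIN j. ereal ((norm (f j - \<eta>))\<^sup>2) + ereal (2 * w) * log_inv (p $ j))"
  proof -
    obtain k where k: "(MIN j. ereal ((norm (f j - \<eta>))\<^sup>2) + ereal (2 * w) * log_inv (p $ j * 1))
        = ereal ((norm (f k - \<eta>))\<^sup>2) + ereal (2 * w) * log_inv (p $ k * 1)"
      using ex_min by blast
    show ?thesis
      using k L_exp[OF pos, of k] bound_eq[of 1 k] by (cases "p $ k = 0") auto
  qed
  ultimately show ?thesis
    using L_int by (simp add: L_def[abs_def] w_def)
qed

end
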